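(* There exists an absolute constant $c>0$ such that for every integer $N\ge 2$ and all complex numbers $a_1,\dots,a_N$, $$\int_0^1 |S_N(\alpha)|\,d\alpha\;\ge\;\frac{c}{N^{1/4}(\log N)^{1/2}}\left(\sum_{n=1}^N \mathbf{1}_p(n)\,|a_n|^2\right)^{1/2},$$ where $S_N(\alpha)=\sum_{n=1}^N \mathbf{1}_p(n)\,a_n\,e(n\alpha)$.
   Context: For real $x$, $e(x)=e^{2\pi i x}$. $\mathbf{1}_p$ denotes the indicator function of the primes: $\mathbf{1}_p(n)=1$ if $n$ is prime and $\mathbf{1}_p(n)=0$ otherwise. Thus $S_N(\alpha)=\sum_{p\le N}a_p e(p\alpha)$, the sum running over primes $p\le N$. *)

theory Defs
  imports "HOL-Analysis.Analysis" "HOL-Computational_Algebra.Primes"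
begin

definition e :: "real \<Rightarrow> complex" where
  "e x = exp (2 * of_real pi * \<i> * of_real x)"

abbreviation prime_ind :: "nat \<Rightarrow> 'a::zero_neq_one" where
  "prime_ind \<equiv> indicator {p. prime p}"

definition prime_exp_sum :: "nat \<Rightarrow> (nat \<Rightarrow> complex) \<Rightarrow> real \<Rightarrow> complex" where
  "prime_exp_sum N a \<alpha> = (\<Sum>n=1..N. prime_ind n * a n * e (real n * \<alpha>))"

end

theory Submission
  imports Defs "HOL-Computational_Algebra.Squarefree"
begin

text \<open>
  Let \<open>Q = \<lfloor>sqrt N\<rfloor>\<close> and write \<open>c\<^sub>q(n)\<close> for the Ramanujan sum, which equals \<open>\<mu>(q)\<close> when \<open>q\<close> is
  squarefree and coprime to \<open>n\<close>. Averaging the Dirichlet kernel over Farey fractions,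
  \<open>\<Sum>\<^sub>q \<mu>(q) \<Sum>\<^sub>a D\<^sub>N(x + a/q)\<close> over squarefree \<open>q \<le> Q\<close>, gives a trigonometric polynomial whose
  coefficient at each prime above \<open>Q\<close> is the number \<open>M \<ge> Q/4\<close> of moduli, and correcting the
  coefficients at the primes up to \<open>Q\<close> is cheap. The Farey fractions are \<open>1/N\<close>-spaced, so this
  kernel is bounded by \<open>O(N log N)\<close> although it consists of about \<open>Q\<^sup>2\<close> Dirichlet kernels.
  Convolution with it multiplies \<open>S\<^sub>N\<close> by \<open>M\<close>, hence the sup norm of \<open>S\<^sub>N\<close> is at most
  \<open>O(sqrt N log N)\<close> times its \<open>L\<^sup>1\<close> norm, and the square of the \<open>L\<^sup>2\<close> norm is at most the product
  of the two.
\<close>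

section \<open>The additive character \<open>e\<close>\<close>

lemma e_0 [simp]: "e 0 = 1"
  by (simp add: e_def)

lemma e_eq_exp: "e x = exp (\<i> * of_real (2 * pi * x))"
  by (simp add: e_def mult_ac)

lemma e_add: "e (x + y) = e x * e y"
  by (simp add: e_def ring_distribs exp_add)

lemma e_of_nat_mult: "e (real n * x) = e x ^ n"
  by (simp add: e_def mult_ac flip: exp_of_nat_mult)

lemma norm_e [simp]: "norm (e x) = 1"
  unfolding e_eq_exp by (rule norm_exp_i_times)

lemma cnj_e: "cnj (e x) = e (- x)"
  by (simp add: e_def exp_cnj)

lemma e_of_int [simp]: "e (of_int k) = 1"
  unfolding e_eq_exp by (subst exp_eq_1) (auto intro!: exI[of _ k])

lemma e_eq_1_imp: "e x = 1 \<Longrightarrow> x \<in> \<int>"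
  unfolding e_eq_exp exp_eq_1 by auto

lemma norm_e_minus_1: "norm (e x - 1) = 2 * \<bar>sin (pi * x)\<bar>"
  using dist_exp_i_1[of "2 * pi * x"] by (simp add: e_eq_exp)

lemma continuous_on_e [continuous_intros]:
  "continuous_on S f \<Longrightarrow> continuous_on S (\<lambda>x. e (f x))"
  unfolding e_def by (intro continuous_intros)

lemma e_has_integral:
  "((\<lambda>x. e (of_int k * x)) has_integral (if k = 0 then 1 else 0)) {0..1}"
proof (cases "k = 0")
  case True
  then show ?thesis using has_integral_const_real[of "1::complex" 0 1] by simp
next
  case False
  define c where "c = 2 * of_real pi * \<i> * of_int k"
  have c: "c \<noteq> 0" using False by (simp add: c_def)
  have eq: "e (of_int k * x) = exp (c * of_real x)" for x
    by (simp add: e_def c_def mult_ac)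
  have "((\<lambda>x. exp (c * of_real x)) has_integral
      (exp (c * of_real 1) / c - exp (c * of_real 0) / c)) {0..1}"
  proof (rule fundamental_theorem_of_calculus)
    fix x :: real
    have "((\<lambda>z. exp (c * z) / c) has_field_derivative exp (c * of_real x)) (at (of_real x))"
      using c by (auto intro!: derivative_eq_intros)
    then show "((\<lambda>x. exp (c * of_real x) / c) has_vector_derivative exp (c * of_real x))
        (at x within {0..1})"
      by (rule has_vector_derivative_real_field)
  qed simp
  moreover have "exp (c * of_real 1) = 1"
    using eq[of 1] by (metis e_of_int mult.right_neutral)
  ultimately show ?thesis using False by (simp add: eq)
qed

section \<open>Orthogonality and reproducing kernels\<close>

text \<open>Orthogonality of the characters leaves only the diagonal of the double sum. The pairing
  is bilinear, so it serves both for convolution with a kernel and, with conjugated coefficients,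
  for Parseval.\<close>

lemma integral_trig_poly_mult:
  fixes a b :: "nat \<Rightarrow> complex"
  assumes "finite A"
  shows "((\<lambda>x. (\<Sum>n\<in>A. a n * e (real n * x)) * (\<Sum>n\<in>A. b n * e (- (real n * x))))
    has_integral (\<Sum>n\<in>A. a n * b n)) {0..1}"
proof -
  have "((\<lambda>x. \<Sum>n\<in>A. \<Sum>m\<in>A. a n * b m * e (of_int (int n - int m) * x)) has_integral
      (\<Sum>n\<in>A. \<Sum>m\<in>A. a n * b m * (if int n - int m = 0 then 1 else 0))) {0..1}"
    using assms by (intro has_integral_sum has_integral_mult_right e_has_integral)
  moreover have "(\<Sum>n\<in>A. \<Sum>m\<in>A. a n * b m * (if int n - int m = 0 then 1 else 0)) = (\<Sum>n\<in>A. a n * b n)"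
    using assms by (simp add: if_distrib sum.delta cong: if_cong)
  moreover have "a n * b m * e (of_int (int n - int m) * x) = (a n * e (real n * x)) * (b m * e (- (real m * x)))"
    for n m x
  proof -
    have "e (of_int (int n - int m) * x) = e (real n * x + - (real m * x))"
      by (simp add: algebra_simps)
    then show ?thesis by (simp only: e_add mult_ac)
  qed
  ultimately show ?thesis unfolding sum_product by (simp only:)
qed

text \<open>Convolution with the kernel multiplies \<open>f\<close> by \<open>M\<close>, so the sup
  norm of \<open>f\<close> is at most \<open>B / M\<close> times its L^1 norm; the squared L^2 norm
  is at most the product of these two norms. The condition \<open>eig\<close> constrains
  \<open>\<kappa> n\<close> only where \<open>a n\<close> is nonzero.\<close>

lemma trig_poly_reproducing_bound:
  fixes a \<kappa> :: "nat \<Rightarrow> complex" and N :: nat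
  defines "f \<equiv> \<lambda>x. \<Sum>n=1..N. a n * e (real n * x)"
  assumes K: "\<And>x. norm (\<Sum>n=1..N. \<kappa> n * e (real n * x)) \<le> B"
    and eig: "\<And>n. n \<in> {1..N} \<Longrightarrow> \<kappa> n * a n = of_real M * a n" and M: "M > 0"
  shows "M * (\<Sum>n=1..N. (norm (a n))\<^sup>2) \<le> B * (integral {0..1} (\<lambda>x. norm (f x)))\<^sup>2"
proof -
  define I where "I = integral {0..1} (\<lambda>x. norm (f x))"
  have cf: "continuous_on S f" for S unfolding f_def by (intro continuous_intros)
  have If: "(\<lambda>x. norm (f x)) integrable_on {0..1}"
    by (intro integrable_continuous_real continuous_intros cf)
  have B: "B \<ge> 0" using order_trans[OF norm_ge_zero K[of 0]] .
  have sup: "M * norm (f x) \<le> B * I" for x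
  proof -
    \<comment> \<open>This is the kernel at \<open>x - y\<close>, expanded as a polynomial in
      \<open>y\<close> so that orthogonality evaluates the convolution integral.\<close>
    define g where "g y = (\<Sum>n=1..N. (\<kappa> n * e (real n * x)) * e (- (real n * y)))" for y
    have gB: "norm (g y) \<le> B" for y
    proof -
      have "g y = (\<Sum>n=1..N. \<kappa> n * e (real n * (x - y)))"
        by (simp add: g_def right_diff_distrib mult.assoc flip: e_add)
      then show ?thesis using K by simp
    qed
    have "((\<lambda>y. f y * g y) has_integral (\<Sum>n=1..N. a n * (\<kappa> n * e (real n * x)))) {0..1}"
      unfolding f_def g_def by (rule integral_trig_poly_mult) simp
    also have "(\<Sum>n=1..N. a n * (\<kappa> n * e (real n * x))) = of_real M * f x"
      unfolding f_def sum_distrib_left using eig by (intro sum.cong) (auto simp: mult_ac)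
    finally have *: "((\<lambda>y. f y * g y) has_integral of_real M * f x) {0..1}" .
    then have "norm (of_real M * f x) = norm (integral {0..1} (\<lambda>y. f y * g y))"
      by (simp add: integral_unique)
    also have "\<dots> \<le> integral {0..1} (\<lambda>y. B * norm (f y))"
      using * gB by (intro integral_norm_bound_integral integrable_on_mult_right If)
        (auto simp: norm_mult mult.commute[of _ "norm (g _)"] intro!: mult_right_mono)
    finally show ?thesis using M by (simp add: norm_mult I_def)
  qed
  have sup': "norm (f x * cnj (f x)) \<le> B * I / M * norm (f x)" for x
  proof -
    have "norm (f x) \<le> B * I / M" using sup[of x] M by (simp add: field_simps)
    from mult_right_mono[OF this norm_ge_zero[of "f x"]] show ?thesis by (simp add: norm_mult)
  qed
  have "((\<lambda>x. f x * (\<Sum>n=1..N. cnj (a n) * e (- (real n * x)))) has_integral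
      (\<Sum>n=1..N. a n * cnj (a n))) {0..1}"
    unfolding f_def by (rule integral_trig_poly_mult) simp
  moreover have "(\<Sum>n=1..N. cnj (a n) * e (- (real n * x))) = cnj (f x)" for x
    by (simp add: f_def cnj_e)
  moreover have "(\<Sum>n=1..N. a n * cnj (a n)) = of_real (\<Sum>n=1..N. (norm (a n))\<^sup>2)"
    by (simp only: of_real_sum complex_norm_square)
  ultimately have *: "((\<lambda>x. f x * cnj (f x)) has_integral of_real (\<Sum>n=1..N. (norm (a n))\<^sup>2)) {0..1}"
    by simp
  have "(\<Sum>n=1..N. (norm (a n))\<^sup>2) = norm (integral {0..1} (\<lambda>x. f x * cnj (f x)))"
    unfolding integral_unique[OF *] norm_of_real by (simp add: sum_nonneg)
  also have "\<dots> \<le> integral {0..1} (\<lambda>x. B * I / M * norm (f x))"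
    using * by (intro integral_norm_bound_integral integrable_on_mult_right If sup') auto
  also have "\<dots> = B * I\<^sup>2 / M" by (simp add: I_def power2_eq_square)
  finally show ?thesis using M by (simp add: I_def field_simps)
qed

section \<open>Dirichlet kernels at well-spaced points\<close>

definition dirichlet_kernel :: "nat \<Rightarrow> real \<Rightarrow> complex" where
  "dirichlet_kernel N x = (\<Sum>n=1..N. e (real n * x))"

lemma dirichlet_kernel_add_int: "dirichlet_kernel N (x + of_int k) = dirichlet_kernel N x"
proof -
  have "e (real n * (x + of_int k)) = e (real n * x)" for n
    using e_of_int[of "int n * k"] by (simp add: ring_distribs e_add)
  then show ?thesis by (simp add: dirichlet_kernel_def)
qed

lemma norm_dirichlet_kernel_le: "norm (dirichlet_kernel N x) \<le> real N"
  unfolding dirichlet_kernel_def by (rule order_trans[OF norm_sum]) simp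

text \<open>On this interval \<open>sin (pi * x)\<close> is concave, hence lies above the chord
  joining its endpoint values \<open>0\<close> and \<open>1\<close>.\<close>

lemma sin_pi_ge:
  assumes "0 \<le> x" "x \<le> 1/2"
  shows "2 * x \<le> sin (pi * x)"
proof -
  have "convex_on {0..1/2} (\<lambda>x. - sin (pi * x))"
  proof (rule convex_on_realI)
    show "((\<lambda>x. - sin (pi * x)) has_real_derivative - pi * cos (pi * x)) (at x)" for x
      by (auto intro!: derivative_eq_intros)
    fix x y :: real assume "x \<in> {0..1/2}" "y \<in> {0..1/2}" "x \<le> y"
    then show "- pi * cos (pi * x) \<le> - pi * cos (pi * y)"
      by (auto intro!: cos_monotone_0_pi_le simp: field_simps)
  qed simp
  from convex_onD[OF this, of "2 * x" 0 "1/2"] assms show ?thesis by simp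
qed

text \<open>Multiplying the geometric sum by \<open>e x - 1\<close> leaves a difference of two
  unimodular numbers. The product form avoids dividing by zero at the endpoints.\<close>

lemma norm_dirichlet_kernel_mult_le:
  assumes "0 \<le> x" "x \<le> 1"
  shows "norm (dirichlet_kernel N x) * (2 * min x (1 - x)) \<le> 1"
proof -
  have "2 * min x (1 - x) \<le> sin (pi * x)"
    using sin_pi_ge[of x] sin_pi_ge[of "1 - x"] assms
    by (cases "x \<le> 1/2") (auto simp: right_diff_distrib sin_diff min_def)
  then have "norm (dirichlet_kernel N x) * (2 * min x (1 - x)) \<le>
      norm (dirichlet_kernel N x) * (norm (e x - 1) / 2)"
    by (intro mult_left_mono) (auto simp: norm_e_minus_1)
  also have "\<dots> = norm ((e x - 1) * (\<Sum>n=1..N. e x ^ n)) / 2"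
    by (simp add: dirichlet_kernel_def e_of_nat_mult norm_mult)
  also have "(e x - 1) * (\<Sum>n=1..N. e x ^ n) = e x ^ Suc N - e x"
    by (induction N) (auto simp: algebra_simps)
  also have "norm (e x ^ Suc N - e x) / 2 \<le> 1"
    using norm_triangle_ineq4[of "e x ^ Suc N" "e x"] by (simp add: norm_power norm_mult)
  finally show ?thesis .
qed

text \<open>In cell \<open>k\<close> of the \<open>N\<close> cells of length \<open>1 / N\<close>,
  the distance to the nearest integer is at least \<open>m / N\<close>. The larger of the bounds
  coming from the two ends is replaced by their sum, which is easy to add up over all cells.\<close>

lemma norm_dirichlet_kernel_cell:
  assumes k: "k < N" and x: "real k \<le> real N * x" "real N * x < real k + 1"
  shows "norm (dirichlet_kernel N x) \<le> real N / real (Suc k) + real N / real (N - k)"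
proof -
  define m where "m = min k (N - Suc k)"
  have N: "N > 0" using k by simp
  have x01: "0 \<le> x" "x \<le> 1"
  proof -
    have "0 \<le> real N * x" "real N * x \<le> real N * 1" using x k by linarith+
    then show "0 \<le> x" "x \<le> 1" using N by (auto simp: zero_le_mult_iff)
  qed
  have "real m \<le> real N * min x (1 - x)"
    using x k by (auto simp: m_def min_def algebra_simps of_nat_diff)
  then have "norm (dirichlet_kernel N x) * (2 * real m) \<le>
      norm (dirichlet_kernel N x) * (2 * (real N * min x (1 - x)))"
    by (intro mult_left_mono) auto
  also have "\<dots> \<le> real N * 1"
    using mult_left_mono[OF norm_dirichlet_kernel_mult_le[OF x01], of "real N" N] by (simp add: mult_ac)
  finally have 1: "norm (dirichlet_kernel N x) * (2 * real m) \<le> real N" by simp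
  \<comment> \<open>In an end cell \<open>m = 0\<close> and the trivial bound \<open>N\<close> takes
    over; elsewhere \<open>m + 1\<close> is at most \<open>2 * m\<close>.\<close>
  have "norm (dirichlet_kernel N x) * (real m + 1) \<le> real N"
  proof (cases "m = 0")
    case True
    then show ?thesis using norm_dirichlet_kernel_le by simp
  next
    case False
    then have "norm (dirichlet_kernel N x) * (real m + 1) \<le> norm (dirichlet_kernel N x) * (2 * real m)"
      by (intro mult_left_mono) auto
    with 1 show ?thesis by linarith
  qed
  then have "norm (dirichlet_kernel N x) \<le> real N / (real m + 1)"
    by (simp add: field_simps)
  also have "real m + 1 = real (min (Suc k) (N - k))"
    using k by (auto simp: m_def min_def)
  also have "real N / \<dots> \<le> real N / real (Suc k) + real N / real (N - k)"
    by (auto simp: min_def)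
  finally show ?thesis .
qed

text \<open>Modulo 1, each half-open cell of length \<open>1 / N\<close> holds at most one of the
  points. The sum is therefore dominated by the cell bounds added over all \<open>N\<close> cells,
  which form two harmonic sums.\<close>

lemma sum_dirichlet_kernel_spaced:
  assumes fin: "finite X" and N: "N > 0"
    and spaced: "\<And>i j m. i \<in> X \<Longrightarrow> j \<in> X \<Longrightarrow> i \<noteq> j \<Longrightarrow> \<bar>x i - x j - of_int m\<bar> \<ge> 1 / real N"
  shows "(\<Sum>i\<in>X. norm (dirichlet_kernel N (x i))) \<le> 2 * real N * harm N"
proof -
  define k where "k i = nat \<lfloor>real N * frac (x i)\<rfloor>" for i
  have k: "real (k i) \<le> real N * frac (x i)" "real N * frac (x i) < real (k i) + 1" for i
    unfolding k_def by (auto simp: frac_ge_0)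
  have kN: "k i < N" for i
  proof -
    have "real N * frac (x i) < real N * 1"
      using N by (intro mult_strict_left_mono) (auto simp: frac_lt_1)
    with k(1)[of i] have "real (k i) < real N" by linarith
    then show ?thesis by simp
  qed
  have inj: "inj_on k X"
  proof (rule inj_onI, rule ccontr)
    fix i j assume ij: "i \<in> X" "j \<in> X" "k i = k j" "i \<noteq> j"
    have "\<bar>real N * frac (x i) - real N * frac (x j)\<bar> < 1"
      using k[of i] k[of j] ij(3) by linarith
    \<comment> \<open>The integer \<open>m\<close> in \<open>spaced\<close> absorbs the difference
      of the floors.\<close>
    also have "real N * frac (x i) - real N * frac (x j) =
        real N * (x i - x j - of_int (\<lfloor>x i\<rfloor> - \<lfloor>x j\<rfloor>))"
      by (simp add: frac_def algebra_simps)
    finally have "\<bar>x i - x j - of_int (\<lfloor>x i\<rfloor> - \<lfloor>x j\<rfloor>)\<bar> < 1 / real N"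
      using N by (simp only: abs_mult abs_of_nat pos_less_divide_eq of_nat_0_less_iff mult.commute)
    with spaced[OF ij(1,2,4), of "\<lfloor>x i\<rfloor> - \<lfloor>x j\<rfloor>"] show False by linarith
  qed
  have "norm (dirichlet_kernel N (x i)) \<le> real N / real (Suc (k i)) + real N / real (N - k i)" for i
  proof -
    have "dirichlet_kernel N (x i) = dirichlet_kernel N (frac (x i))"
      using dirichlet_kernel_add_int[of N "frac (x i)" "\<lfloor>x i\<rfloor>"] by (simp add: frac_def)
    then show ?thesis using norm_dirichlet_kernel_cell[OF kN k] by simp
  qed
  then have "(\<Sum>i\<in>X. norm (dirichlet_kernel N (x i))) \<le>
      (\<Sum>i\<in>X. real N / real (Suc (k i)) + real N / real (N - k i))"
    by (intro sum_mono)
  also have "\<dots> = (\<Sum>j\<in>k ` X. real N / real (Suc j) + real N / real (N - j))"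
    using inj by (simp add: sum.reindex)
  also have "\<dots> \<le> (\<Sum>j<N. real N / real (Suc j) + real N / real (N - j))"
    using kN by (intro sum_mono2) auto
  also have "(\<Sum>j<N. real N / real (N - j)) = (\<Sum>j<N. real N / real (Suc j))"
    by (rule sum.reindex_bij_witness[of _ "\<lambda>j. N - Suc j" "\<lambda>j. N - Suc j"]) auto
  then have "(\<Sum>j<N. real N / real (Suc j) + real N / real (N - j)) = 2 * real N * harm N"
    unfolding sum.distrib harm_altdef by (simp add: divide_inverse flip: sum_distrib_left)
  finally show ?thesis .
qed

section \<open>Spacing of Farey fractions\<close>

text \<open>Over the denominator \<open>q * r\<close> the difference has an integer numerator, and
  this is nonzero because distinct reduced fractions in \<open>[0, 1)\<close> stay distinct modulo
  1.\<close>

lemma farey_spaced: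
  fixes a b q r :: nat
  assumes "a < q" "b < r" "coprime a q" "coprime b r" "(q, a) \<noteq> (r, b)"
  shows "\<bar>real a / real q - real b / real r - of_int m\<bar> \<ge> 1 / (real q * real r)"
proof -
  define k where "k = int a * int r - int b * int q - m * int q * int r"
  have pos: "q > 0" "r > 0" using assms by auto
  have eq: "real a / real q - real b / real r - of_int m = of_int k / (real q * real r)"
    using pos by (simp add: k_def field_simps)
  have "k \<noteq> 0"
  proof
    assume "k = 0"
    then have "real a / real q - real b / real r = of_int m" using eq by simp
    moreover have "0 \<le> real a / real q" "real a / real q < 1" "0 \<le> real b / real r" "real b / real r < 1"
      using assms by auto
    ultimately have "of_int m < (1::real)" "of_int m > (-1::real)" by linarith+
    then have "m = 0" by linarith
    with \<open>k = 0\<close> have *: "a * r = b * q"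
      unfolding k_def by (simp flip: of_nat_mult)
    have "q dvd a * r" "r dvd b * q" using * by (metis dvd_triv_right)+
    then have "q dvd r" "r dvd q"
      using assms(3,4) by (simp_all add: coprime_commute coprime_dvd_mult_right_iff)
    then have "q = r" by (rule dvd_antisym)
    with * pos have "a = b" by simp
    with \<open>q = r\<close> assms(5) show False by simp
  qed
  then have "\<bar>real_of_int k\<bar> \<ge> 1" by linarith
  then show ?thesis unfolding eq using pos by (simp add: field_simps)
qed

section \<open>Ramanujan sums at squarefree moduli\<close>

text \<open>Starting the residues at \<open>0\<close> makes the modulus \<open>1\<close> contribute
  the single fraction \<open>0\<close>, and keeps all fractions in \<open>[0, 1)\<close>.\<close>

definition ramanujan_sum :: "nat \<Rightarrow> nat \<Rightarrow> complex" where
  "ramanujan_sum q n = (\<Sum>a | a < q \<and> coprime a q. e (real n * (real a / real q)))"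

lemma norm_ramanujan_sum_le: "norm (ramanujan_sum q n) \<le> real q"
proof -
  have "norm (ramanujan_sum q n) \<le> real (card {a. a < q \<and> coprime a q})"
    unfolding ramanujan_sum_def by (rule order_trans[OF norm_sum]) simp
  also have "card {a. a < q \<and> coprime a q} \<le> card {..<q}"
    by (rule card_mono) auto
  finally show ?thesis by simp
qed

text \<open>The residues below \<open>p * m\<close> coprime to \<open>m\<close> split into those
  prime to \<open>p\<close>, giving the left-hand sum, and the multiples of \<open>p\<close>, giving
  the sum for \<open>m\<close>. Their total vanishes because a shift by \<open>m\<close> multiplies
  a term by \<open>w\<close>, a nontrivial \<open>p\<close>-th root of unity.\<close>

lemma ramanujan_sum_prime_mult:
  assumes p: "prime p" and pm: "\<not> p dvd m" and pn: "\<not> p dvd n"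
  shows "ramanujan_sum (p * m) n = - ramanujan_sum m n"
proof -
  define g where "g a = e (real n * (real a / real (p * m)))" for a
  define w where "w = e (real n / real p)"
  define U where "U = {a. a < p * m \<and> coprime a m}"
  define V where "V = {a. a < p * m \<and> coprime a (p * m)}"
  define W where "W = {b. b < m \<and> coprime b m}"
  have p0: "p > 0" and m0: "m > 0" using p pm by (auto simp: prime_gt_0_nat intro: Nat.gr0I)
  have w1: "w \<noteq> 1"
  proof
    assume "w = 1"
    then have "real n / real p \<in> \<int>" unfolding w_def by (rule e_eq_1_imp)
    then obtain k where "real n / real p = of_int k" by (auto elim: Ints_cases)
    then have "real n = of_int (k * int p)" using p0 by (simp add: field_simps)
    then have "int n = k * int p" by linarith
    then have "int p dvd int n" by simp
    with pn show False by simp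
  qed
  have wp: "w ^ p = 1"
    using p0 e_of_int[of "int n"] unfolding w_def by (simp flip: e_of_nat_mult)
  have shift: "g (b + j * m) = g b * w ^ j" for b j
    using p0 m0 unfolding g_def w_def by (simp add: field_simps flip: e_of_nat_mult e_add)
  have cop: "coprime (b + j * m) m \<longleftrightarrow> coprime b m" for b j
    by (simp add: coprime_iff_gcd_eq_1 gcd.commute[of _ m] add.commute[of b] gcd_add_mult)
  define h where "h a = (if coprime a m then g a else 0)" for a
  \<comment> \<open>Block \<open>{j * m..<(j + 1) * m}\<close> contributes \<open>w\<^sup>j\<close> times block \<open>0\<close>, and the powers of \<open>w\<close> cancel.\<close>
  have "sum g U = sum h {..<p * m}"
    unfolding U_def h_def by (subst sum.inter_filter[symmetric]) (auto simp: lessThan_def)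
  also have "\<dots> = (\<Sum>j<p. \<Sum>b<m. h (b + j * m))"
    using sum.shift_bounds_nat_ivl[of h 0 _ m]
    unfolding sum.nat_group[symmetric] by (simp add: add.commute[of m] lessThan_atLeast0)
  also have "\<dots> = (\<Sum>j<p. \<Sum>b<m. w ^ j * (if coprime b m then g b else 0))"
    by (intro sum.cong refl) (simp add: h_def cop shift)
  also have "\<dots> = 0"
    using w1 wp by (simp add: geometric_sum flip: sum_distrib_left sum_distrib_right)
  finally have U0: "sum g U = 0" .
  have "U = V \<union> (*) p ` W"
  proof (intro set_eqI iffI)
    fix a assume a: "a \<in> U"
    show "a \<in> V \<union> (*) p ` W"
    proof (cases "p dvd a")
      case True
      then obtain b where "a = p * b" by auto
      with a p0 show ?thesis by (auto simp: U_def W_def)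
    next
      case False
      then have "coprime p a" using p by (simp add: prime_imp_coprime)
      with a show ?thesis by (auto simp: U_def V_def coprime_commute)
    qed
  next
    fix a assume "a \<in> V \<union> (*) p ` W"
    moreover have "coprime p m" using p pm by (simp add: prime_imp_coprime)
    ultimately show "a \<in> U" using p0 by (auto simp: U_def V_def W_def)
  qed
  moreover have "V \<inter> (*) p ` W = {}"
    using p by (auto simp: V_def not_prime_unit)
  moreover have "finite V" "finite W" by (auto simp: V_def W_def)
  ultimately have "sum g U = sum g V + sum g ((*) p ` W)"
    by (simp add: sum.union_disjoint)
  also have "sum g ((*) p ` W) = (\<Sum>b\<in>W. g (p * b))"
    using p0 by (subst sum.reindex) (auto simp: inj_on_def)
  also have "\<dots> = ramanujan_sum m n"
    unfolding ramanujan_sum_def W_def[symmetric] using p0 by (simp add: g_def)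
  also have "sum g V = ramanujan_sum (p * m) n"
    by (simp add: ramanujan_sum_def V_def g_def)
  finally show ?thesis using U0 by (simp add: eq_neg_iff_add_eq_0)
qed

text \<open>The right-hand side is the Moebius function at a squarefree \<open>q\<close>. Each prime
  stripped from \<open>q\<close> flips the sign, down to the modulus \<open>1\<close>.\<close>

lemma ramanujan_sum_squarefree:
  fixes q n :: nat
  assumes "squarefree q" "coprime n q"
  shows "ramanujan_sum q n = (- 1) ^ card (prime_factors q)"
  using assms
proof (induction q rule: less_induct)
  case (less q)
  have q0: "q > 0" using less.prems by (auto intro: Nat.gr0I)
  show ?case
  proof (cases "q = 1")
    case True
    then have "{a. a < q \<and> coprime a q} = {0}" by auto
    then show ?thesis using True by (simp add: ramanujan_sum_def)
  next
    case False
    then obtain p where p: "prime p" "p dvd q" using prime_factor_nat by blast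
    then obtain m where m: "q = p * m" by auto
    have pm: "\<not> p dvd m"
    proof
      assume "p dvd m"
      then have "p\<^sup>2 dvd q" by (simp add: m power2_eq_square)
      then have "p dvd 1" using less.prems(1) squarefreeD by blast
      with p(1) show False by (simp add: not_prime_unit)
    qed
    have m0: "m > 0" and mq: "m < q" using q0 m prime_gt_1_nat[OF p(1)] by auto
    have np: "\<not> p dvd n" and nm: "coprime n m"
      using less.prems(2) p(1) by (auto simp: m prime_nat_iff coprime_commute dest: coprime_common_divisor)
    have sm: "squarefree m" using less.prems(1) by (rule squarefree_mono[rotated]) (simp add: m)
    have "prime_factors q = insert p (prime_factors m)"
      using m0 p(1) prime_gt_0_nat[OF p(1)]
      by (simp add: m prime_factors_product prime_prime_factors)
    moreover have "p \<notin> prime_factors m" using pm by auto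
    ultimately have "card (prime_factors q) = Suc (card (prime_factors m))" by simp
    then show ?thesis
      using ramanujan_sum_prime_mult[OF p(1) pm np] less.IH[OF mq sm nm] by (simp add: m)
  qed
qed

section \<open>Counting squarefree numbers\<close>

lemma card_multiples_le:
  fixes n Q :: nat
  assumes "n > 0"
  shows "real (card {q \<in> {1..Q}. n dvd q}) \<le> real Q / real n"
proof -
  have "{q \<in> {1..Q}. n dvd q} \<subseteq> (*) n ` {1..Q div n}"
  proof
    fix q assume q: "q \<in> {q \<in> {1..Q}. n dvd q}"
    then obtain k where k: "q = n * k" by auto
    with q assms have "k \<in> {1..Q div n}" by (auto simp: less_eq_div_iff_mult_less_eq mult.commute)
    with k show "q \<in> (*) n ` {1..Q div n}" by blast
  qed
  then have "card {q \<in> {1..Q}. n dvd q} \<le> card ((*) n ` {1..Q div n})"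
    by (intro card_mono) auto
  also have "\<dots> \<le> card {1..Q div n}" by (rule card_image_le) simp
  finally have "real (card {q \<in> {1..Q}. n dvd q}) \<le> real (Q div n)" by simp
  also have "\<dots> \<le> real Q / real n" by (rule of_nat_div_le_of_nat)
  finally show ?thesis .
qed

lemma sum_inverse_squares_le: "(\<Sum>d=2..Q. 1 / (real d)\<^sup>2) \<le> 3 / 4"
proof -
  \<comment> \<open>The extra \<open>- 1 / real Q\<close> makes the induction telescope; equality
    holds at \<open>Q = 2\<close>, which fixes the constant \<open>3 / 4\<close>.\<close>
  have "(\<Sum>d=2..Q. 1 / (real d)\<^sup>2) \<le> 3 / 4 - 1 / real Q" if "Q \<ge> 2"
    using that
  proof (induction Q rule: dec_induct)
    case base
    then show ?case by simp
  next
    case (step Q)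
    have "1 / (real (Suc Q))\<^sup>2 \<le> 1 / (real Q * real (Suc Q))"
      using step.hyps by (intro divide_left_mono) (auto simp: power2_eq_square)
    also have "\<dots> = 1 / real Q - 1 / real (Suc Q)"
      using step.hyps by (simp add: field_simps)
    finally show ?case using step by simp
  qed
  then show ?thesis by (cases "Q \<ge> 2") (fastforce elim: order_trans, simp)
qed

text \<open>Union bound: a number that is not squarefree is a multiple of some \<open>d^2\<close>
  with \<open>d\<close> at least \<open>2\<close>, and these multiples make up at most three
  quarters of the range.\<close>

lemma card_squarefree_ge: "real (card {q \<in> {1..Q}. squarefree q}) \<ge> real Q / 4"
proof -
  let ?S = "{q \<in> {1..Q}. squarefree q}" and ?T = "\<lambda>d. {q \<in> {1..Q}. d\<^sup>2 dvd q}"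
  have "{1..Q} \<subseteq> ?S \<union> (\<Union>d\<in>{2..Q}. ?T d)"
  proof
    fix q assume q: "q \<in> {1..Q}"
    show "q \<in> ?S \<union> (\<Union>d\<in>{2..Q}. ?T d)"
    proof (cases "squarefree q")
      case False
      then obtain d where d: "d\<^sup>2 dvd q" "\<not> d dvd 1" by (rule not_squarefreeE)
      have "d\<^sup>2 \<le> q" using d(1) q by (auto intro: dvd_imp_le)
      moreover have "d \<le> d\<^sup>2" by (simp add: power2_eq_square)
      moreover have "d \<noteq> 0" using d q by (intro notI) auto
      ultimately have "d \<in> {2..Q}" using d(2) q by (cases "d = 1") auto
      with d q show ?thesis by blast
    qed (use q in auto)
  qed
  then have "card {1..Q} \<le> card (?S \<union> (\<Union>d\<in>{2..Q}. ?T d))" by (rule card_mono[rotated]) auto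
  also have "\<dots> \<le> card ?S + (\<Sum>d=2..Q. card (?T d))"
    by (rule order_trans[OF card_Un_le add_left_mono[OF card_UN_le]]) simp
  finally have "real Q \<le> real (card ?S) + (\<Sum>d=2..Q. real (card (?T d)))"
    by (simp flip: of_nat_sum of_nat_add)
  also have "(\<Sum>d=2..Q. real (card (?T d))) \<le> (\<Sum>d=2..Q. real Q * (1 / (real d)\<^sup>2))"
    using card_multiples_le[of "_\<^sup>2" Q] by (intro sum_mono) auto
  also have "\<dots> \<le> real Q * (3 / 4)"
    unfolding sum_distrib_left[symmetric] by (intro mult_left_mono sum_inverse_squares_le) auto
  finally show ?thesis by linarith
qed

section \<open>The kernel adapted to the primes\<close>

text \<open>The Farey average \<open>k\<close> already equals \<open>M\<close> at primes above
  \<open>Q\<close>; overwriting it at all primes at most doubles the bound. Elsewhere the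
  coefficients are whatever the average produces, since the kernel is meant for sums supported on
  primes.\<close>

lemma prime_kernel:
  fixes N :: nat
  assumes N: "N > 0"
  obtains \<kappa> :: "nat \<Rightarrow> complex" and M :: real
  where "M \<ge> sqrt (real N) / 8"
    and "\<And>p. prime p \<Longrightarrow> \<kappa> p = of_real M"
    and "\<And>x. norm (\<Sum>n=1..N. \<kappa> n * e (real n * x)) \<le> 4 * real N * harm N"
proof -
  \<comment> \<open>The largest order with \<open>Q * Q\<close> at most \<open>N\<close>, so that
    the Farey fractions remain \<open>1 / N\<close>-spaced.\<close>
  define Q where "Q = nat \<lfloor>sqrt (real N)\<rfloor>"
  define S where "S = {q \<in> {1..Q}. squarefree q}"
  define U where "U q = {a. a < q \<and> coprime a q}" for q :: nat
  \<comment> \<open>The Moebius sign: unimodular, hence free in norm estimates, and equal to the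
    Ramanujan sum at \<open>n\<close> coprime to \<open>q\<close>, so the product of the two is
    \<open>1\<close>.\<close>
  define s where "s q = (- 1 :: complex) ^ card (prime_factors q)" for q :: nat
  define k where "k n = (\<Sum>q\<in>S. s q * ramanujan_sum q n)" for n
  define M where "M = real (card S)"
  define \<kappa> where "\<kappa> n = (if prime n then of_real M else k n)" for n
  have sN: "sqrt (real N) \<ge> 1" using N by simp
  have Q: "real Q \<le> sqrt (real N)" "sqrt (real N) < real Q + 1"
    using sN unfolding Q_def by linarith+
  have Q1: "Q \<ge> 1" using Q(2) sN by linarith
  have QQ: "real Q * real Q \<le> real N"
    using mult_mono[OF Q(1) Q(1)] sN by simp
  have finS: "finite S" and finU: "finite (U q)" for q by (auto simp: S_def U_def)
  have s: "norm (s q) = 1" "s q * s q = 1" for q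
    by (simp_all add: s_def norm_power flip: power_mult_distrib)
  \<comment> \<open>Since \<open>Q\<close> is at least \<open>1\<close>,
    \<open>sqrt N < Q + 1\<close> is at most \<open>2 * Q\<close>, while \<open>M\<close> is at
    least \<open>Q / 4\<close>.\<close>
  have M: "M \<ge> sqrt (real N) / 8"
    using card_squarefree_ge[of Q] Q Q1 unfolding M_def S_def by linarith
  have bound1: "norm (\<Sum>n=1..N. k n * e (real n * x)) \<le> 2 * real N * harm N" for x
  proof -
    have "(\<Sum>n=1..N. k n * e (real n * x)) =
        (\<Sum>n=1..N. \<Sum>q\<in>S. \<Sum>a\<in>U q. s q * e (real n * (x + real a / real q)))"
      unfolding k_def ramanujan_sum_def U_def[symmetric]
      by (simp add: sum_distrib_left sum_distrib_right distrib_left e_add mult_ac)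
    also have "\<dots> = (\<Sum>q\<in>S. \<Sum>a\<in>U q. s q * dirichlet_kernel N (x + real a / real q))"
      unfolding dirichlet_kernel_def sum_distrib_left
      by (subst sum.swap, rule sum.cong[OF refl], rule sum.swap)
    also have "norm \<dots> \<le> (\<Sum>q\<in>S. \<Sum>a\<in>U q. norm (dirichlet_kernel N (x + real a / real q)))"
      by (intro sum_norm_le) (simp add: norm_mult s)
    also have "\<dots> = (\<Sum>i\<in>Sigma S U. norm (dirichlet_kernel N (x + real (snd i) / real (fst i))))"
      using finS finU by (simp add: sum.Sigma split_beta)
    also have "\<dots> \<le> 2 * real N * harm N"
    proof (rule sum_dirichlet_kernel_spaced)
      fix i j :: "nat \<times> nat" and m :: int
      assume ij: "i \<in> Sigma S U" "j \<in> Sigma S U" "i \<noteq> j"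
      obtain q a r b where [simp]: "i = (q, a)" "j = (r, b)" by (cases i, cases j)
      have "1 / real N \<le> 1 / (real q * real r)"
      proof (rule divide_left_mono)
        have "real q * real r \<le> real Q * real Q"
          using ij by (intro mult_mono) (auto simp: S_def)
        with QQ show "real q * real r \<le> real N" by linarith
        show "0 < real N * (real q * real r)" using ij N by (auto simp: S_def)
      qed simp
      also have "\<dots> \<le> \<bar>real a / real q - real b / real r - of_int m\<bar>"
        using ij by (intro farey_spaced) (auto simp: U_def)
      finally show "1 / real N \<le> \<bar>(x + real (snd i) / real (fst i)) -
          (x + real (snd j) / real (fst j)) - of_int m\<bar>"
        by simp
    qed (use finS finU N in auto)
    finally show ?thesis .
  qed
  \<comment> \<open>For prime \<open>n\<close> only the moduli divisible by \<open>n\<close>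
    contribute: at most \<open>Q / n\<close> of them, each at most \<open>1 + q\<close>, hence at
    most \<open>2 * Q\<close>.\<close>
  have corr: "norm (\<kappa> n - k n) \<le> 2 * real N * (1 / real n)" if n: "n \<in> {1..N}" for n
  proof (cases "prime n")
    case True
    define S' where "S' = {q \<in> {1..Q}. n dvd q}"
    have "\<kappa> n - k n = (\<Sum>q\<in>S. 1 - s q * ramanujan_sum q n)"
      using True by (simp add: \<kappa>_def k_def M_def sum_subtractf)
    also have "norm \<dots> \<le> (\<Sum>q\<in>S. if n dvd q then 2 * real Q else 0)"
    proof (rule sum_norm_le)
      fix q assume q: "q \<in> S"
      show "norm (1 - s q * ramanujan_sum q n) \<le> (if n dvd q then 2 * real Q else 0)"
      proof (cases "n dvd q")
        case True
        have "norm (1 - s q * ramanujan_sum q n) \<le> 1 + norm (ramanujan_sum q n)"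
          using norm_triangle_ineq4[of 1 "s q * ramanujan_sum q n"] by (simp add: norm_mult s)
        also have "\<dots> \<le> 1 + real q" by (simp add: norm_ramanujan_sum_le)
        also have "\<dots> \<le> 2 * real Q" using q Q1 by (auto simp: S_def)
        finally show ?thesis using True by simp
      next
        case False
        then have "coprime n q" using \<open>prime n\<close> by (simp add: prime_imp_coprime)
        then have "ramanujan_sum q n = s q"
          using q unfolding s_def by (intro ramanujan_sum_squarefree) (auto simp: S_def)
        then show ?thesis by (simp add: s)
      qed
    qed
    also have "\<dots> \<le> (\<Sum>q\<in>{1..Q}. if n dvd q then 2 * real Q else 0)"
      by (rule sum_mono2) (auto simp: S_def)
    also have "\<dots> = (\<Sum>q\<in>S'. 2 * real Q)"
      unfolding S'_def by (rule sum.inter_filter[symmetric]) simp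
    also have "\<dots> = real (card S') * (2 * real Q)" by simp
    also have "\<dots> \<le> real Q / real n * (2 * real Q)"
      using n unfolding S'_def by (intro mult_right_mono card_multiples_le) auto
    also have "\<dots> = 2 * (real Q * real Q) * (1 / real n)" by simp
    also have "\<dots> \<le> 2 * real N * (1 / real n)"
      using QQ by (intro mult_right_mono) auto
    finally show ?thesis .
  qed (simp add: \<kappa>_def)
  have "norm (\<Sum>n=1..N. \<kappa> n * e (real n * x)) \<le> 4 * real N * harm N" for x
  proof -
    have "(\<Sum>n=1..N. \<kappa> n * e (real n * x)) =
        (\<Sum>n=1..N. k n * e (real n * x)) + (\<Sum>n=1..N. (\<kappa> n - k n) * e (real n * x))"
      by (simp add: algebra_simps flip: sum.distrib)
    \<comment> \<open>The corrections decay like \<open>1 / n\<close>, so the triangle inequality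
      loses only another harmonic sum.\<close>
    also have "norm \<dots> \<le> 2 * real N * harm N + (\<Sum>n=1..N. 2 * real N * (1 / real n))"
      using corr by (intro norm_triangle_mono bound1 sum_norm_le) (auto simp: norm_mult)
    also have "(\<Sum>n=1..N. 2 * real N * (1 / real n)) = 2 * real N * harm N"
      by (simp add: harm_def sum_distrib_left divide_inverse)
    finally show ?thesis by (simp add: mult_ac)
  qed
  with M show ?thesis by (intro that[of M \<kappa>]) (auto simp: \<kappa>_def)
qed

section \<open>The lower bound for the L^1 norm\<close>

theorem theorem8:
  shows "\<exists>c::real. c > 0 \<and>
    (\<forall>N::nat. \<forall>a::nat \<Rightarrow> complex. N \<ge> 2 \<longrightarrow>
      integral {0..1} (\<lambda>\<alpha>::real. norm (prime_exp_sum N a \<alpha>))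
        \<ge> c / (real N powr (1/4) * sqrt (ln (real N)))
            * sqrt (\<Sum>n=1..N. prime_ind n * (norm (a n))\<^sup>2))"
proof (intro exI[of _ "1/9"] conjI allI impI)
  fix N :: nat and a :: "nat \<Rightarrow> complex"
  assume N: "N \<ge> 2"
  define I where "I = integral {0..1} (\<lambda>\<alpha>. norm (prime_exp_sum N a \<alpha>))"
  define T where "T = (\<Sum>n=1..N. prime_ind n * (norm (a n))\<^sup>2)"
  define R where "R = sqrt (real N)"
  have I0: "I \<ge> 0" unfolding I_def prime_exp_sum_def
    by (intro integral_nonneg integrable_continuous_real continuous_intros) simp
  have "N > 0" using N by simp
  then obtain \<kappa> M where "M \<ge> sqrt (real N) / 8"
    and \<kappa>: "\<And>p. prime p \<Longrightarrow> \<kappa> p = of_real M"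
    and K: "\<And>x. norm (\<Sum>n=1..N. \<kappa> n * e (real n * x)) \<le> 4 * real N * harm N"
    by (rule prime_kernel) (rule that)
  then have M: "M \<ge> R / 8" by (simp add: R_def)
  have R: "R > 0" "R * R = real N" using N by (auto simp: R_def)
  have T0: "T \<ge> 0" unfolding T_def by (intro sum_nonneg) (auto simp: indicator_def)
  have "ln 2 \<le> ln (real N)" using N by simp
  then have L: "ln (real N) \<ge> 2 / 3" using ln2_ge_two_thirds by linarith
  \<comment> \<open>Monotonicity of \<open>harm N - ln N\<close> gives \<open>harm N\<close> at most
    \<open>1 + ln N\<close>, and \<open>1\<close> is at most \<open>3 / 2 * ln N\<close> by
    \<open>L\<close>.\<close>
  have harm: "harm N \<le> 5 / 2 * ln (real N)"
    using euler_mascheroni_sequence_decreasing[of 1 N] N L by (simp add: harm_expand)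
  have T: "T = (\<Sum>n=1..N. (norm (prime_ind n * a n))\<^sup>2)"
    unfolding T_def by (intro sum.cong) (auto simp: indicator_def)
  have "R / 8 * T \<le> M * T" using M T0 by (rule mult_right_mono)
  also have "\<dots> \<le> 4 * real N * harm N * I\<^sup>2"
    unfolding T I_def prime_exp_sum_def
    \<comment> \<open>The eigenvalue condition holds at primes by the choice of
      \<open>\<kappa>\<close>, and elsewhere because the coefficient is zero.\<close>
    by (rule trig_poly_reproducing_bound[OF K]) (use \<kappa> M R in \<open>auto simp: indicator_def\<close>)
  also have "\<dots> \<le> 4 * real N * (5 / 2 * ln (real N)) * I\<^sup>2"
    using harm by (intro mult_right_mono mult_left_mono) auto
  also have "\<dots> = R * (10 * R * ln (real N) * I\<^sup>2)" by (simp flip: R(2))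
  finally have "R * T \<le> R * (80 * R * ln (real N) * I\<^sup>2)" by (simp add: mult_ac)
  then have "T \<le> 80 * R * ln (real N) * I\<^sup>2" using R(1) by simp
  \<comment> \<open>Rounding \<open>80\<close> up to the square \<open>81\<close> yields the
    constant \<open>1/9\<close> after taking roots.\<close>
  also have "\<dots> \<le> 81 * R * ln (real N) * I\<^sup>2"
    using R(1) L by (intro mult_right_mono) auto
  also have "\<dots> = (9 * (sqrt R * sqrt (ln (real N)) * I))\<^sup>2"
    using R(1) L by (simp add: power_mult_distrib)
  finally have "sqrt T \<le> 9 * (sqrt R * sqrt (ln (real N)) * I)"
    using R(1) L I0 by (intro real_le_lsqrt) auto
  moreover have "sqrt R = real N powr (1 / 4)"
    unfolding R_def using N by (simp add: powr_half_sqrt[symmetric] powr_powr)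
  ultimately have "sqrt T \<le> 9 * (real N powr (1 / 4) * sqrt (ln (real N)) * I)" by simp
  moreover have "real N powr (1 / 4) * sqrt (ln (real N)) > 0" using N L by auto
  ultimately show "1 / 9 / (real N powr (1/4) * sqrt (ln (real N))) *
      sqrt (\<Sum>n=1..N. prime_ind n * (norm (a n))\<^sup>2)
      \<le> integral {0..1} (\<lambda>\<alpha>. norm (prime_exp_sum N a \<alpha>))"
    unfolding T_def[symmetric] I_def[symmetric] by (simp add: field_simps)
qed simp

end
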